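(* Let $n\ge 1$ and let $f:\mathbb{D}^n\to\mathbb{D}$ be holomorphic. If the extreme set $X(f)$ has nonempty interior, then $X(f)=\mathbb{D}^n$ (i.e. $f$ is everywhere infinitesimally extremal).
   Context: $\mathbb{D}=\{\zeta\in\mathbb{C}:|\zeta|<1\}$ is the open unit disk and $\mathbb{D}^n$ is the polydisk. For a holomorphic function $f:\mathbb{D}^n\to\mathbb{D}$, the extreme set of $f$ is $$X(f):=\left\{z\in\mathbb{D}^n : 1-|f(z)|^2=\sum_{i=1}^n(1-|z_i|^2)\left|\frac{\partial f}{\partial z_i}(z)\right|\right\}.$$ The function $f$ is called everywhere infinitesimally extremal if $X(f)=\mathbb{D}^n$. *)

theory Defs
  imports "HOL-Complex_Analysis.Complex_Analysis"
begin

definition polydisk :: "(complex ^ 'n) set"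
  where "polydisk = {z. \<forall>i. z $ i \<in> ball 0 1}"

text \<open>
  Holomorphy in several variables as complex Frechet differentiability: the real derivative
  exists at every point and is complex linear. The set is meant to be open.
\<close>

definition holomorphic_several_on :: "(complex ^ 'n \<Rightarrow> complex) \<Rightarrow> (complex ^ 'n) set \<Rightarrow> bool"
    (infixl "(holomorphic'_several'_on)" 50)
  where "f holomorphic_several_on S \<longleftrightarrow>
    (\<forall>z\<in>S. \<exists>f'. (f has_derivative f') (at z) \<and> (\<forall>c h. f' (c *s h) = c * f' h))"

definition partial_deriv :: "'n \<Rightarrow> (complex ^ 'n \<Rightarrow> complex) \<Rightarrow> complex ^ 'n \<Rightarrow> complex"
  where "partial_deriv i f z = deriv (\<lambda>w. f (\<chi> j. if j = i then w else z $ j)) (z $ i)"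

definition extreme_set :: "(complex ^ 'n \<Rightarrow> complex) \<Rightarrow> (complex ^ 'n) set"
  where "extreme_set f = {z \<in> polydisk.
    1 - (cmod (f z))\<^sup>2 = (\<Sum>i\<in>UNIV. (1 - (cmod (z $ i))\<^sup>2) * cmod (partial_deriv i f z))}"

definition everywhere_infinitesimally_extremal :: "(complex ^ 'n \<Rightarrow> complex) \<Rightarrow> bool"
  where "everywhere_infinitesimally_extremal f \<longleftrightarrow> extreme_set f = polydisk"

end

theory Submission
  imports Defs "HOL-Real_Asymp.Real_Asymp"
begin

text \<open>
  Off the zeros of the partial derivatives that do not vanish identically, both sides of the
  equation defining the extreme set are real analytic. Restrict it to the complex line through an
  interior point of the extreme set and an arbitrary point of the polydisk: there the zeros to be
  avoided form a countable set, whose complement is connected and dense. The equation therefore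
  spreads over this complement by analytic continuation and over the whole line by continuity.
\<close>

section \<open>Restriction to complex lines and partial derivatives\<close>

lemma bounded_linear_vector_scale: "bounded_linear (\<lambda>\<zeta>. \<zeta> *s b :: complex ^ 'n)"
  by (rule linear_conv_bounded_linear[THEN iffD1])
    (auto intro!: linearI simp: vec_eq_iff algebra_simps)

text \<open>By the chain rule the real derivative of the restriction is
  \<open>\<zeta> \<mapsto> f' (\<zeta> *s b)\<close>; complex linearity turns it into multiplication
  by \<open>f' b\<close>, which is a complex derivative.\<close>

lemma has_field_derivative_along_line:
  fixes f :: "complex ^ 'n \<Rightarrow> complex"
  assumes "(f has_derivative f') (at (a + \<zeta> *s b))" and "\<And>c h. f' (c *s h) = c * f' h"
  shows "((\<lambda>\<zeta>. f (a + \<zeta> *s b)) has_field_derivative f' b) (at \<zeta>)"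
proof -
  have "((\<lambda>\<zeta>. a + \<zeta> *s b) has_derivative (\<lambda>\<zeta>. \<zeta> *s b)) (at \<zeta>)"
    using bounded_linear_imp_has_derivative[OF bounded_linear_vector_scale]
    by (auto intro!: derivative_eq_intros)
  from has_derivative_compose[OF this assms(1)]
  show ?thesis
    by (simp add: has_field_derivative_def assms(2) mult.commute[of _ "f' b"])
qed

lemma holomorphic_several_onE:
  assumes "f holomorphic_several_on S" "z \<in> S"
  obtains f' where "(f has_derivative f') (at z)" "\<And>c h. f' (c *s h) = c * f' h"
  using assms unfolding holomorphic_several_on_def by blast

lemma holomorphic_several_on_imp_continuous_on:
  assumes "f holomorphic_several_on S"
  shows "continuous_on S f"
proof (rule continuous_at_imp_continuous_on, rule ballI)
  fix z assume "z \<in> S"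
  with assms show "isCont f z"
    by (elim holomorphic_several_onE) (auto intro: has_derivative_continuous)
qed

lemma holomorphic_several_on_along_line:
  fixes f :: "complex ^ 'n \<Rightarrow> complex"
  assumes "f holomorphic_several_on S" "\<And>\<zeta>. \<zeta> \<in> T \<Longrightarrow> a + \<zeta> *s b \<in> S"
  shows "(\<lambda>\<zeta>. f (a + \<zeta> *s b)) holomorphic_on T"
  unfolding holomorphic_on_def
proof
  fix \<zeta> assume "\<zeta> \<in> T"
  with assms obtain f' where "(f has_derivative f') (at (a + \<zeta> *s b))"
      "\<And>c h. f' (c *s h) = c * f' h"
    by (meson holomorphic_several_onE)
  from has_field_derivative_along_line[OF this]
  show "(\<lambda>\<zeta>. f (a + \<zeta> *s b)) field_differentiable at \<zeta> within T"
    using field_differentiable_at_within field_differentiable_def by blast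
qed

text \<open>Varying coordinate \<open>i\<close> alone is motion along a complex line in the
  direction \<open>axis i 1\<close>. With the base point \<open>a\<close> whose coordinate
  \<open>i\<close> is 0, the line parameter is the coordinate itself, so \<open>z\<close> is reached
  at \<open>z $ i\<close>.\<close>

lemma partial_deriv_eq_derivative_axis:
  fixes f :: "complex ^ 'n \<Rightarrow> complex"
  assumes "(f has_derivative f') (at z)" "\<And>c h. f' (c *s h) = c * f' h"
  shows "partial_deriv i f z = f' (axis i 1)"
proof -
  define a where "a = z - z $ i *s axis i 1"
  have eq: "(\<chi> j. if j = i then w else z $ j) = a + w *s axis i 1" for w
    by (auto simp: vec_eq_iff a_def axis_def)
  have "a + z $ i *s axis i 1 = z"
    by (simp add: a_def)
  with assms have "((\<lambda>w. f (a + w *s axis i 1)) has_field_derivative f' (axis i 1)) (at (z $ i))"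
    by (intro has_field_derivative_along_line) auto
  then show ?thesis
    unfolding partial_deriv_def eq by (rule DERIV_imp_deriv)
qed

lemma norm_scale_axis: "norm (c *s axis i 1 :: complex ^ 'n) = cmod c"
proof -
  have "c *s axis i 1 = (axis i c :: complex ^ 'n)"
    by (auto simp: vec_eq_iff axis_def)
  then show ?thesis
    by (simp add: norm_vec_def axis_def L2_set_def if_distrib[of "\<lambda>x. (cmod x)\<^sup>2"] cong: if_cong)
qed

section \<open>Holomorphy of partial derivatives along lines\<close>

text \<open>Cauchy's inequality on disks of radius \<open>r / 2\<close> bounds
  \<open>deriv G\<close> on \<open>ball 0 r\<close>, and the mean value inequality on this convex
  ball carries the bound over to the quotient. The bound is independent of \<open>t\<close>, as
  Montel's theorem requires.\<close>

lemma difference_quotient_bound: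
  assumes "G holomorphic_on ball 0 (2 * r)" "\<And>w. w \<in> ball 0 (2 * r) \<Longrightarrow> cmod (G w) \<le> B"
    and "t \<in> ball 0 r" "t \<noteq> 0"
  shows "cmod ((G t - G 0) / t) \<le> B / (r / 2)"
proof -
  have r: "0 < r"
    using assms(3) by (smt (verit) dist_0_norm mem_ball norm_ge_zero)
  have deriv_le: "cmod (deriv G w) \<le> B / (r / 2)" if "w \<in> ball 0 r" for w
  proof -
    have sub: "cball w (r / 2) \<subseteq> ball 0 (2 * r)"
    proof
      fix x assume "x \<in> cball w (r / 2)"
      then show "x \<in> ball 0 (2 * r)"
        using that r norm_triangle_ineq2[of x w] by (auto simp: dist_norm norm_minus_commute)
    qed
    have "cmod ((deriv ^^ 1) G w) \<le> fact 1 * B / (r / 2) ^ 1"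
    proof (rule Cauchy_inequality)
      show "G holomorphic_on ball w (r / 2)"
        using assms(1) sub ball_subset_cball holomorphic_on_subset by blast
      show "continuous_on (cball w (r / 2)) G"
        using assms(1) sub holomorphic_on_imp_continuous_on continuous_on_subset by blast
      show "cmod (G x) \<le> B" if "cmod (w - x) = r / 2" for x
        using that sub assms(2) by (auto simp: dist_norm subset_iff)
    qed (use r in auto)
    then show ?thesis
      by simp
  qed
  have "cmod (G t - G 0) \<le> B / (r / 2) * cmod (t - 0)"
  proof (rule field_differentiable_bound[where S = "ball 0 r" and f' = "deriv G"])
    show "(G has_field_derivative deriv G z) (at z within ball 0 r)" if "z \<in> ball 0 r" for z
      using that r by (intro DERIV_subset[OF holomorphic_derivI[OF assms(1)]]) auto
  qed (use deriv_le assms(3) r in auto)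
  then show ?thesis
    using assms(4) by (simp add: norm_divide pos_divide_le_eq)
qed

text \<open>
  The difference quotients in direction \<open>i\<close> are locally bounded, so by Montel's theorem their
  pointwise limit is holomorphic.
\<close>

lemma holomorphic_partial_deriv_along_line:
  fixes f :: "complex ^ 'n \<Rightarrow> complex"
  assumes "open S" and hol: "f holomorphic_several_on S"
  shows "(\<lambda>\<zeta>. partial_deriv i f (a + \<zeta> *s b)) holomorphic_on {\<zeta>. a + \<zeta> *s b \<in> S}"
  unfolding holomorphic_on_def
proof
  fix \<zeta>0 assume "\<zeta>0 \<in> {\<zeta>. a + \<zeta> *s b \<in> S}"
  define e :: "complex ^ 'n" where "e = axis i 1"
  have cont: "continuous_on UNIV (\<lambda>\<zeta>. a + \<zeta> *s b)"
    by (intro continuous_on_add continuous_on_const linear_continuous_on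
        bounded_linear_vector_scale)
  \<comment> \<open>The radius \<open>3 * r\<close> leaves room for \<open>r\<close> from moving the
    base point along the line and \<open>2 * r\<close> from the displacement in direction
    \<open>e\<close>.\<close>
  obtain r where r: "0 < r" "cball (a + \<zeta>0 *s b) (3 * r) \<subseteq> S"
  proof -
    obtain \<epsilon> where "0 < \<epsilon>" "cball (a + \<zeta>0 *s b) \<epsilon> \<subseteq> S"
      using \<open>open S\<close> \<open>\<zeta>0 \<in> _\<close> open_contains_cball by blast
    then show ?thesis
      by (intro that[of "\<epsilon> / 3"]) auto
  qed
  have "open ((\<lambda>\<zeta>. a + \<zeta> *s b) -` ball (a + \<zeta>0 *s b) r)"
    using cont by (intro open_vimage) auto
  then obtain d where d: "0 < d" "ball \<zeta>0 d \<subseteq> (\<lambda>\<zeta>. a + \<zeta> *s b) -` ball (a + \<zeta>0 *s b) r"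
    using r(1) by (metis centre_in_ball openE vimage_eq)
  have near: "a + \<zeta> *s b + w *s e \<in> cball (a + \<zeta>0 *s b) (3 * r)"
    if "\<zeta> \<in> ball \<zeta>0 d" "w \<in> ball 0 (2 * r)" for \<zeta> w
  proof -
    have "dist (a + \<zeta>0 *s b) (a + \<zeta> *s b) < r"
      using d(2) that(1) by auto
    moreover have "dist (a + \<zeta> *s b) (a + \<zeta> *s b + w *s e) < 2 * r"
      using that(2) by (simp add: dist_norm norm_scale_axis e_def)
    ultimately show ?thesis
      using dist_triangle[of "a + \<zeta>0 *s b" "a + \<zeta> *s b + w *s e" "a + \<zeta> *s b"] by simp
  qed
  have "compact (f ` cball (a + \<zeta>0 *s b) (3 * r))"
    using holomorphic_several_on_imp_continuous_on[OF hol] r(2)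
    by (intro compact_continuous_image) (auto intro: continuous_on_subset)
  then obtain B where B: "\<And>z. z \<in> cball (a + \<zeta>0 *s b) (3 * r) \<Longrightarrow> cmod (f z) \<le> B"
    by (metis bounded_iff compact_imp_bounded image_eqI)
  \<comment> \<open>The summand 2 keeps even \<open>t 0\<close> strictly inside
    \<open>ball 0 r\<close>.\<close>
  define t :: "nat \<Rightarrow> complex" where "t n = of_real (r / (real n + 2))" for n
  have t0: "t n \<noteq> 0" for n
    using r(1) by (simp add: t_def del: of_real_divide)
  have tball: "t n \<in> ball 0 r" for n
  proof -
    have "0 < r + r * real n"
      using r(1) by (simp add: add_pos_nonneg)
    then show ?thesis
      using r(1) by (simp add: t_def pos_divide_less_eq distrib_left del: of_real_divide)
  qed
  have t_lim: "t \<longlonglongrightarrow> 0"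
  proof -
    have "(\<lambda>n. r / (real n + 2)) \<longlonglongrightarrow> 0"
      by real_asymp
    then show ?thesis
      unfolding t_def by (metis of_real_0 tendsto_of_real)
  qed
  define F where "F n \<zeta> = (f (a + \<zeta> *s b + t n *s e) - f (a + \<zeta> *s b)) / t n" for n \<zeta>
  have F_hol: "F n holomorphic_on ball \<zeta>0 d" for n
  proof -
    have "(\<lambda>\<zeta>. f ((a + w *s e) + \<zeta> *s b)) holomorphic_on ball \<zeta>0 d"
      if "w \<in> ball 0 (2 * r)" for w
      using near[OF _ that] r(2)
      by (intro holomorphic_several_on_along_line[OF hol]) (auto simp: algebra_simps)
    from this[of "t n"] this[of 0] show ?thesis
      using tball[of n] r(1) t0 unfolding F_def
      by (intro holomorphic_intros) (auto simp: algebra_simps)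
  qed
  have F_bound: "cmod (F n \<zeta>) \<le> B / (r / 2)" if "\<zeta> \<in> ball \<zeta>0 d" for n \<zeta>
  proof -
    have "(\<lambda>w. f ((a + \<zeta> *s b) + w *s e)) holomorphic_on ball 0 (2 * r)"
      using near[OF that] r(2) by (intro holomorphic_several_on_along_line[OF hol]) auto
    from difference_quotient_bound[OF this _ tball[of n] t0] near[OF that] B
    show ?thesis
      by (auto simp: F_def)
  qed
  have F_lim: "(\<lambda>n. F n \<zeta>) \<longlonglongrightarrow> partial_deriv i f (a + \<zeta> *s b)" if "\<zeta> \<in> ball \<zeta>0 d" for \<zeta>
  proof -
    have "a + \<zeta> *s b \<in> S"
      using near[OF that, of 0] r by auto
    then obtain f' where f': "(f has_derivative f') (at (a + \<zeta> *s b))"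
        "\<And>c h. f' (c *s h) = c * f' h"
      using hol by (meson holomorphic_several_onE)
    then have "((\<lambda>w. f ((a + \<zeta> *s b) + w *s e)) has_field_derivative f' e) (at 0)"
      by (intro has_field_derivative_along_line) auto
    then have "((\<lambda>h. (f (a + \<zeta> *s b + h *s e) - f (a + \<zeta> *s b)) / h) \<longlongrightarrow> f' e) (at 0)"
      by (simp add: DERIV_def)
    moreover have "filterlim t (at 0) sequentially"
      using t_lim t0 by (simp add: filterlim_at)
    ultimately show ?thesis
      unfolding partial_deriv_eq_derivative_axis[OF f'] F_def e_def
      by (rule filterlim_compose)
  qed
  obtain g k where g: "g holomorphic_on ball \<zeta>0 d" and k: "strict_mono (k :: nat \<Rightarrow> nat)"
    and lim: "\<And>\<zeta>. \<zeta> \<in> ball \<zeta>0 d \<Longrightarrow> (\<lambda>n. F (k n) \<zeta>) \<longlonglongrightarrow> g \<zeta>"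
  proof (rule Montel[of "ball \<zeta>0 d" "range F" F])
    show "\<exists>B. \<forall>h\<in>range F. \<forall>z\<in>K. cmod (h z) \<le> B" if "compact K" "K \<subseteq> ball \<zeta>0 d" for K
      using F_bound that by blast
  qed (use F_hol in auto)
  \<comment> \<open>Montel's theorem provides only a convergent subsequence, but the whole sequence
    already converges pointwise to the partial derivative, so this is the limit.\<close>
  have "g \<zeta> = partial_deriv i f (a + \<zeta> *s b)" if "\<zeta> \<in> ball \<zeta>0 d" for \<zeta>
    using LIMSEQ_unique[OF lim[OF that] LIMSEQ_subseq_LIMSEQ[OF F_lim[OF that] k, unfolded o_def]] .
  then have "(\<lambda>\<zeta>. partial_deriv i f (a + \<zeta> *s b)) holomorphic_on ball \<zeta>0 d"
    using holomorphic_transform[OF g] by simp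
  then show "(\<lambda>\<zeta>. partial_deriv i f (a + \<zeta> *s b)) field_differentiable
      at \<zeta>0 within {\<zeta>. a + \<zeta> *s b \<in> S}"
    by (rule field_differentiable_at_within[OF holomorphic_on_imp_differentiable_at])
      (use d(1) in auto)
qed

section \<open>Analytic continuation of the identity on convex plane domains\<close>

text \<open>
  On the real axis \<open>cnj (u (cnj t))\<close> is the conjugate of \<open>u t\<close>, so after the substitution
  \<open>\<bar>S\<^sup>2\<bar> = S * cnj S\<close> both sides of the identity restricted to a segment extend
  holomorphically, and one-variable analytic continuation applies.
\<close>

lemma modulus_identity_extends_convex:
  fixes h :: "complex \<Rightarrow> complex" and l s :: "'i \<Rightarrow> complex \<Rightarrow> complex"
  assumes W: "open W" "convex W"
    and hol: "h holomorphic_on W" "\<And>i. i \<in> I \<Longrightarrow> l i holomorphic_on W"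
      "\<And>i. i \<in> I \<Longrightarrow> s i holomorphic_on W"
    and V: "open V" "q \<in> V" "q \<in> W"
    and eq: "\<And>z. z \<in> V \<inter> W \<Longrightarrow> 1 - (cmod (h z))\<^sup>2 = (\<Sum>i\<in>I. (1 - (cmod (l i z))\<^sup>2) * cmod ((s i z)\<^sup>2))"
    and "p \<in> W"
  shows "1 - (cmod (h p))\<^sup>2 = (\<Sum>i\<in>I. (1 - (cmod (l i p))\<^sup>2) * cmod ((s i p)\<^sup>2))"
proof -
  define L where "L t = q + t * (p - q)" for t :: complex
  \<comment> \<open>Both \<open>t\<close> and \<open>cnj t\<close> have to be mapped into
    \<open>W\<close> for \<open>star\<close> to be holomorphic at \<open>t\<close>. Since
    \<open>L\<close> is affine, \<open>N\<close> inherits convexity from \<open>W\<close> and is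
    therefore connected.\<close>
  define N where "N = L -` W \<inter> cnj -` L -` W"
  define star where "star u t = u (L t) * cnj (u (L (cnj t)))" for u and t :: complex
  define F where "F t = 1 - star h t - (\<Sum>i\<in>I. (1 - star (l i) t) * star (s i) t)" for t
  have L_lin: "L (x *\<^sub>R t + y *\<^sub>R t') = x *\<^sub>R L t + y *\<^sub>R L t'" if "x + y = 1" for x y t t'
  proof -
    have "q = of_real (x + y) * q"
      using that by simp
    then show ?thesis
      by (simp add: L_def scaleR_conv_of_real algebra_simps)
  qed
  have "isCont L t" for t
    unfolding L_def by (intro continuous_intros)
  then have oLW: "open (L -` W)"
    using W(1) by (intro open_vimage continuous_at_imp_continuous_on) auto
  then have oN: "open N"
    unfolding N_def by (intro open_Int open_vimage[of "L -` W" cnj]) (auto intro: continuous_intros)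
  have "convex N"
    unfolding convex_def
  proof (intro ballI allI impI)
    fix t t' and x y :: real
    assume "t \<in> N" "t' \<in> N" "0 \<le> x" "0 \<le> y" "x + y = 1"
    then show "x *\<^sub>R t + y *\<^sub>R t' \<in> N"
      using W(2) L_lin unfolding N_def by (auto simp: convex_def)
  qed
  have L_hol: "L holomorphic_on A" for A
    unfolding L_def by (intro holomorphic_intros)
  have star_hol: "star u holomorphic_on N" if "u holomorphic_on W" for u
  proof -
    have 1: "(u \<circ> L) holomorphic_on N"
      by (intro holomorphic_on_compose_gen[OF L_hol that]) (auto simp: N_def)
    have "(u \<circ> L) holomorphic_on cnj ` N"
      by (intro holomorphic_on_compose_gen[OF L_hol that]) (auto simp: N_def)
    from holomorphic_on_compose_cnj_cnj[OF this oN] 1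
    show ?thesis
      unfolding star_def by (auto simp: o_def intro!: holomorphic_intros)
  qed
  have F_hol: "F holomorphic_on N"
    unfolding F_def by (intro holomorphic_intros star_hol hol) auto
  have star_real: "star u (of_real x) = of_real ((cmod (u (L x)))\<^sup>2)" for u x
    by (simp add: star_def complex_norm_square del: of_real_power)
  have F_real: "F (of_real x) = of_real (1 - (cmod (h (L x)))\<^sup>2 -
      (\<Sum>i\<in>I. (1 - (cmod (l i (L x)))\<^sup>2) * cmod ((s i (L x))\<^sup>2)))" for x
    unfolding F_def star_real by (simp add: norm_power)
  have "open (L -` (V \<inter> W))"
    using V(1) W(1) \<open>\<And>t. isCont L t\<close>
    by (intro open_vimage continuous_at_imp_continuous_on open_Int) auto
  moreover have L0: "L 0 = q" and L1: "L 1 = p"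
    by (simp_all add: L_def)
  ultimately obtain d where d: "0 < d" "ball 0 d \<subseteq> L -` (V \<inter> W)"
    using V by (metis IntI open_contains_ball_eq vimageI)
  \<comment> \<open>The hypothesis yields zeros of \<open>F\<close> only at real \<open>t\<close>,
    where \<open>star\<close> is a squared modulus. A real segment ending at 0 already accumulates
    at a point of \<open>N\<close>.\<close>
  define U where "U = complex_of_real ` {0<..<d}"
  have U_ball: "U \<subseteq> ball 0 d"
    by (auto simp: U_def)
  have UN: "U \<subseteq> N"
  proof
    fix t assume "t \<in> U"
    then have "L t \<in> W" "cnj t = t"
      using d(2) U_ball by (auto simp: U_def)
    then show "t \<in> N"
      by (simp add: N_def)
  qed
  have lim: "0 islimpt U"
    unfolding islimpt_approachable
  proof (intro allI impI)
    fix \<epsilon> :: real assume "0 < \<epsilon>"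
    then show "\<exists>x'\<in>U. x' \<noteq> 0 \<and> dist x' 0 < \<epsilon>"
      using d(1) unfolding U_def
      by (intro bexI[of _ "of_real (min (\<epsilon> / 2) (d / 2))"] imageI) auto
  qed
  have "F 1 = 0"
  proof (rule analytic_continuation[OF F_hol oN _ UN _ lim])
    show "connected N"
      using \<open>convex N\<close> convex_connected by blast
    show "0 \<in> N" "1 \<in> N"
      using V(3) \<open>p \<in> W\<close> by (auto simp: N_def L0 L1)
    show "F z = 0" if "z \<in> U" for z
    proof -
      obtain x where x: "z = of_real x"
        using \<open>z \<in> U\<close> by (auto simp: U_def)
      have "L z \<in> V \<inter> W"
        using that d(2) U_ball by blast
      from eq[OF this] show ?thesis
        unfolding x F_real by simp
    qed
  qed
  then have "complex_of_real (1 - (cmod (h p))\<^sup>2 -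
      (\<Sum>i\<in>I. (1 - (cmod (l i p))\<^sup>2) * cmod ((s i p)\<^sup>2))) = 0"
    using F_real[of 1] L1 by simp
  then show ?thesis
    unfolding of_real_eq_0_iff by simp
qed

section \<open>Continuation across the zeros of the coefficients\<close>

text \<open>The modulus of \<open>g i\<close> is the squared modulus of a holomorphic function only
  where \<open>g i\<close> has a holomorphic square root. Such roots exist on balls without zeros of
  \<open>g i\<close>, so the convex case is chained through overlapping balls that avoid these
  zeros.\<close>

lemma modulus_identity_extends:
  fixes h :: "complex \<Rightarrow> complex" and l g :: "'i \<Rightarrow> complex \<Rightarrow> complex"
  assumes \<Omega>: "open \<Omega>" "connected \<Omega>" and "finite I"
    and hol: "h holomorphic_on \<Omega>" "\<And>i. i \<in> I \<Longrightarrow> l i holomorphic_on \<Omega>"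
      "\<And>i. i \<in> I \<Longrightarrow> g i holomorphic_on \<Omega>"
    and V: "open V" "V \<noteq> {}" "V \<subseteq> \<Omega>"
    and eq: "\<And>z. z \<in> V \<Longrightarrow> 1 - (cmod (h z))\<^sup>2 = (\<Sum>i\<in>I. (1 - (cmod (l i z))\<^sup>2) * cmod (g i z))"
    and "p \<in> \<Omega>"
  shows "1 - (cmod (h p))\<^sup>2 = (\<Sum>i\<in>I. (1 - (cmod (l i p))\<^sup>2) * cmod (g i p))"
proof -
  define D where "D z = 1 - (cmod (h z))\<^sup>2 - (\<Sum>i\<in>I. (1 - (cmod (l i z))\<^sup>2) * cmod (g i z))" for z
  \<comment> \<open>An index whose \<open>g i\<close> vanishes identically contributes nothing to
    the sum, but its zeros would fill \<open>\<Omega>\<close>; only the zeros of the other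
    \<open>g i\<close> are removed.\<close>
  define J where "J = {i \<in> I. \<exists>z\<in>\<Omega>. g i z \<noteq> 0}"
  define Z where "Z = (\<Union>i\<in>J. {z \<in> \<Omega>. g i z = 0})"
  have J: "finite J" "J \<subseteq> I"
    using \<open>finite I\<close> by (auto simp: J_def)
  obtain K :: "nat \<Rightarrow> complex set" where "\<And>n. compact (K n)" "\<Omega> = (\<Union>n. K n)"
    by (rule open_Union_compact_subsets[OF \<Omega>(1)]) auto
  then have "fsigma \<Omega>"
    using fsigma.intros[of K] by (simp add: compact_imp_closed)
  have "countable {z \<in> \<Omega>. g i z = 0}" if "i \<in> J" for i
  \<comment> \<open>The countability of zeros holds for nonconstant functions; a constant
    \<open>g i\<close> with \<open>i\<close> in \<open>J\<close> has no zeros at all.\<close>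
  proof (cases "g i constant_on \<Omega>")
    case True
    with that have "{z \<in> \<Omega>. g i z = 0} = {}"
      by (auto simp: J_def constant_on_def)
    then show ?thesis
      by (metis countable_empty)
  next
    case False
    with that show ?thesis
      using \<Omega> hol(3) J(2) \<open>fsigma \<Omega>\<close> by (intro holomorphic_countable_zeros) auto
  qed
  then have countZ: "countable Z"
    unfolding Z_def using J(1) by (auto intro: countable_finite)
  have outside_Z: "\<exists>x\<in>S. x \<notin> Z" if S: "open S" "S \<noteq> {}" for S
  proof -
    obtain x r where "0 < r" "ball x r \<subseteq> S"
      using S open_contains_ball by blast
    moreover have "\<not> ball x r \<subseteq> Z"
      using countZ uncountable_ball[OF \<open>0 < r\<close>] countable_subset by blast
    ultimately show ?thesis
      by blast
  qed
  have conn: "connected (\<Omega> - Z)"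
    using \<Omega> countZ by (intro connected_open_diff_countable) auto
  have D_cont: "continuous_on \<Omega> D"
    unfolding D_def by (intro continuous_intros holomorphic_on_imp_continuous_on hol)
  have openZ: "open (\<Omega> - Z)"
  proof -
    \<comment> \<open>The outer intersection with \<open>\<Omega>\<close> covers the case of empty
      \<open>J\<close>, where the indexed intersection is the whole plane.\<close>
    have "\<Omega> - Z = \<Omega> \<inter> (\<Inter>i\<in>J. \<Omega> \<inter> g i -` (- {0}))"
      by (auto simp: Z_def)
    moreover have "open (\<Omega> \<inter> g i -` (- {0}))" if "i \<in> J" for i
      using \<Omega>(1) hol(3)[of i] that J(2)
      by (intro continuous_open_preimage holomorphic_on_imp_continuous_on) auto
    then have "open (\<Omega> \<inter> (\<Inter>i\<in>J. \<Omega> \<inter> g i -` (- {0})))"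
      using \<Omega>(1) J(1) by (intro open_Int open_INT) auto
    ultimately show ?thesis
      by (simp only:)
  qed
  \<comment> \<open>If \<open>D\<close> vanishes near one point of a ball that avoids
    \<open>Z\<close>, it vanishes on the whole ball: each \<open>g i\<close> is a square there, by
    contractibility of the ball for \<open>i\<close> in \<open>J\<close> and with root 0
    otherwise.\<close>
  have local: "D z = 0" if ball: "ball c r \<subseteq> \<Omega> - Z" and "open T" "q \<in> T" "q \<in> ball c r"
    and T: "\<And>z. z \<in> T \<Longrightarrow> D z = 0" and "z \<in> ball c r" for c r T q z
  proof -
    have "\<exists>s. s holomorphic_on ball c r \<and> (\<forall>z\<in>ball c r. g i z = (s z)\<^sup>2)" if "i \<in> I" for i
    proof (cases "i \<in> J")
      case True
      show ?thesis
      proof (rule contractible_imp_holomorphic_sqrt[of "g i" "ball c r"])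
        show "g i holomorphic_on ball c r"
          using hol(3)[OF that] ball holomorphic_on_subset by blast
        show "g i z \<noteq> 0" if "z \<in> ball c r" for z
          using that ball True by (auto simp: Z_def)
      qed (auto intro: convex_imp_contractible)
    next
      case False
      with that ball show ?thesis
        by (intro exI[of _ "\<lambda>_. 0"]) (auto simp: J_def)
    qed
    then obtain s where s: "\<And>i. i \<in> I \<Longrightarrow> s i holomorphic_on ball c r"
        "\<And>i z. i \<in> I \<Longrightarrow> z \<in> ball c r \<Longrightarrow> g i z = (s i z)\<^sup>2"
      by metis
    have sum_eq: "(\<Sum>i\<in>I. (1 - (cmod (l i z))\<^sup>2) * cmod (g i z)) =
        (\<Sum>i\<in>I. (1 - (cmod (l i z))\<^sup>2) * cmod ((s i z)\<^sup>2))" if "z \<in> ball c r" for z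
      using s(2) that by (intro sum.cong) auto
    have "1 - (cmod (h z))\<^sup>2 = (\<Sum>i\<in>I. (1 - (cmod (l i z))\<^sup>2) * cmod ((s i z)\<^sup>2))"
    proof (rule modulus_identity_extends_convex[where W = "ball c r" and V = T and q = q])
      show "1 - (cmod (h z))\<^sup>2 = (\<Sum>i\<in>I. (1 - (cmod (l i z))\<^sup>2) * cmod ((s i z)\<^sup>2))"
        if "z \<in> T \<inter> ball c r" for z
        using T[of z] that sum_eq[of z] by (simp add: D_def)
      show "h holomorphic_on ball c r"
        using hol(1) ball holomorphic_on_subset by blast
      show "l i holomorphic_on ball c r" if "i \<in> I" for i
        using hol(2)[OF that] ball holomorphic_on_subset by blast
    qed (use that s in auto)
    then show ?thesis
      using sum_eq that by (simp add: D_def)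
  qed
  \<comment> \<open>The interior of the zero set is open by construction. It is relatively closed by
    \<open>local\<close>: a ball around a limit point contains a point of \<open>T\<close>, so
    \<open>D\<close> vanishes on the entire ball.\<close>
  define T where "T = interior {z \<in> \<Omega> - Z. D z = 0}"
  have T_sub: "T \<subseteq> \<Omega> - Z" and T0: "\<And>z. z \<in> T \<Longrightarrow> D z = 0"
    using interior_subset by (auto simp: T_def)
  have "closedin (top_of_set (\<Omega> - Z)) T"
    unfolding closedin_limpt
  proof (intro conjI allI impI T_sub)
    fix x assume x: "x islimpt T \<and> x \<in> \<Omega> - Z"
    then obtain r where r: "0 < r" "ball x r \<subseteq> \<Omega> - Z"
      using openZ openE by blast
    then obtain q where "q \<in> T" "q \<in> ball x r"
      using x by (meson centre_in_ball islimptE open_ball)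
    then have "ball x r \<subseteq> {z \<in> \<Omega> - Z. D z = 0}"
      using local[OF r(2) _ \<open>q \<in> T\<close> _ T0] r(2) by (auto simp: T_def)
    then show "x \<in> T"
      unfolding T_def using r(1) by (meson centre_in_ball interiorI open_ball)
  qed
  moreover have "openin (top_of_set (\<Omega> - Z)) T"
    using T_sub by (simp add: T_def open_subset)
  moreover have "T \<noteq> {}"
  proof -
    obtain v where "v \<in> V" "v \<notin> Z"
      using outside_Z[OF V(1,2)] by blast
    moreover have "V \<inter> (\<Omega> - Z) \<subseteq> T"
      unfolding T_def using V(1) openZ eq by (intro interior_maximal) (auto simp: D_def)
    ultimately show ?thesis
      using V(3) by blast
  qed
  ultimately have "T = \<Omega> - Z"
    using conn by (metis connected_clopen)
  \<comment> \<open>By continuity the points with \<open>D\<close> nonzero form an open set. Were it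
    nonempty, it would contain a point outside the countable set \<open>Z\<close>, where
    \<open>D\<close> is 0.\<close>
  have "open (\<Omega> \<inter> D -` (- {0}))"
    using \<Omega>(1) D_cont by (intro continuous_open_preimage) auto
  then have "\<Omega> \<inter> D -` (- {0}) = {}"
    using outside_Z T0 \<open>T = \<Omega> - Z\<close> by blast
  with \<open>p \<in> \<Omega>\<close> show ?thesis
    by (auto simp: D_def)
qed

section \<open>The polydisk and the reduction to complex lines\<close>

lemma open_polydisk: "open (polydisk :: (complex ^ 'n) set)"
proof -
  have "polydisk = (\<Inter>i. (\<lambda>z :: complex ^ 'n. z $ i) -` ball 0 1)"
    by (auto simp: polydisk_def)
  moreover have "open ((\<lambda>z :: complex ^ 'n. z $ i) -` ball 0 1)" for i
    by (intro open_vimage open_ball continuous_intros)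
  ultimately show ?thesis
    using open_INT[of UNIV "\<lambda>i. (\<lambda>z :: complex ^ 'n. z $ i) -` ball 0 1"]
    by (simp only: finite) blast
qed

theorem theorem1p8:
  fixes f :: "complex ^ 'n \<Rightarrow> complex"
  assumes "f holomorphic_several_on polydisk"
    and "f ` polydisk \<subseteq> ball 0 1"
    and "interior (extreme_set f) \<noteq> {}"
  shows "everywhere_infinitesimally_extremal f"
proof -
  obtain a where a: "a \<in> interior (extreme_set f)"
    using assms(3) by blast
  have "p \<in> extreme_set f" if p: "p \<in> polydisk" for p
  proof -
    define L where "L \<zeta> = a + \<zeta> *s (p - a)" for \<zeta>
    \<comment> \<open>This slice of the polydisk is an intersection of preimages of disks under
      affine maps, hence convex, which gives the connectedness needed for continuation from
      parameter 0 (the point \<open>a\<close>) to parameter 1 (the point \<open>p\<close>).\<close>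
    define \<Omega> where "\<Omega> = {\<zeta>. L \<zeta> \<in> polydisk}"
    have L01: "L 0 = a" "L 1 = p"
      by (simp_all add: L_def)
    have L_nth: "L \<zeta> $ i = a $ i + \<zeta> * (p $ i - a $ i)" for \<zeta> i
      by (simp add: L_def algebra_simps)
    have cont: "continuous_on UNIV L"
      unfolding L_def
      by (intro continuous_on_add continuous_on_const linear_continuous_on
          bounded_linear_vector_scale)
    have "convex \<Omega>"
    proof -
      have "\<Omega> = (\<Inter>i. {\<zeta>. a $ i + \<zeta> * (p $ i - a $ i) \<in> ball 0 1})"
        by (auto simp: \<Omega>_def polydisk_def L_nth)
      moreover have "convex {\<zeta>. c + \<zeta> * d \<in> ball 0 1}" for c d :: complex
      proof -
        have "{\<zeta>. c + \<zeta> * d \<in> ball 0 1} = (\<lambda>\<zeta>. \<zeta> * d) -` ball (- c) 1"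
          by (auto simp: dist_norm norm_minus_commute add.commute)
        then show ?thesis
          by (simp add: convex_linear_vimage bounded_linear.linear bounded_linear_mult_left)
      qed
      ultimately show ?thesis
        by (auto intro: convex_INT)
    qed
    have "1 - (cmod (f (L 1)))\<^sup>2 =
      (\<Sum>i\<in>UNIV. (1 - (cmod (L 1 $ i))\<^sup>2) * cmod (partial_deriv i f (L 1)))"
    proof (rule modulus_identity_extends[where \<Omega> = \<Omega> and V = "L -` interior (extreme_set f)"
          and h = "\<lambda>\<zeta>. f (L \<zeta>)" and l = "\<lambda>i \<zeta>. L \<zeta> $ i" and g = "\<lambda>i \<zeta>. partial_deriv i f (L \<zeta>)"])
      show "open \<Omega>"
        using open_vimage[OF open_polydisk cont] by (simp add: \<Omega>_def vimage_def)
      show "connected \<Omega>"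
        using \<open>convex \<Omega>\<close> convex_connected by blast
      show "(\<lambda>\<zeta>. f (L \<zeta>)) holomorphic_on \<Omega>"
        unfolding L_def
        by (rule holomorphic_several_on_along_line[OF assms(1)]) (simp add: \<Omega>_def L_def)
      show "(\<lambda>\<zeta>. L \<zeta> $ i) holomorphic_on \<Omega>" for i
        unfolding L_nth by (intro holomorphic_intros)
      show "(\<lambda>\<zeta>. partial_deriv i f (L \<zeta>)) holomorphic_on \<Omega>" for i
        using holomorphic_partial_deriv_along_line[OF open_polydisk assms(1)]
        unfolding \<Omega>_def L_def .
      show "open (L -` interior (extreme_set f))"
        using cont by (intro open_vimage) auto
      show "L -` interior (extreme_set f) \<noteq> {}"
        using a L01 by blast
      show "L -` interior (extreme_set f) \<subseteq> \<Omega>"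
        using interior_subset[of "extreme_set f"] by (auto simp: \<Omega>_def extreme_set_def)
      show "1 - (cmod (f (L z)))\<^sup>2 =
          (\<Sum>i\<in>UNIV. (1 - (cmod (L z $ i))\<^sup>2) * cmod (partial_deriv i f (L z)))"
        if "z \<in> L -` interior (extreme_set f)" for z
        using that interior_subset[of "extreme_set f"] by (auto simp: extreme_set_def)
    qed (use p L01 in \<open>auto simp: \<Omega>_def\<close>)
    then show ?thesis
      using p L01 by (simp add: extreme_set_def)
  qed
  then show ?thesis
    unfolding everywhere_infinitesimally_extremal_def by (auto simp: extreme_set_def)
qed

end
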